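(* Every finite simple graph is an induced subgraph of some distance critical graph.
   Context: All graphs are finite, simple and undirected. For vertices $x,y$ of a graph $G$, $d_G(x,y)$ is the length of a shortest path from $x$ to $y$ in $G$ ($\infty$ if none exists). A graph $G$ is distance critical if for every vertex $v \in V(G)$ there exist vertices $x,y \in V(G)\setminus\{v\}$ with $d_G(x,y) \neq d_{G-v}(x,y)$. *)

theory Defs
  imports "Graph_Theory.Graph_Theory" "HOL-Library.Extended_Nat"
begin

text \<open>
  A finite simple undirected graph is a finite, loop-free, symmetric digraph without parallel
  arcs (the locale \<^locale>\<open>graph\<close>); an undirected edge is a pair of opposite arcs.
\<close>

text \<open>If there is no path, the infimum is that of the empty set, which is \<open>\<infinity>\<close> in \<^typ>\<open>enat\<close>.\<close>

definition graph_dist :: "('a, 'b) pre_digraph \<Rightarrow> 'a \<Rightarrow> 'a \<Rightarrow> enat" where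
  "graph_dist G x y = (INF p \<in> {p. pre_digraph.apath G x p y}. enat (length p))"

definition distance_critical :: "('a, 'b) pre_digraph \<Rightarrow> bool" where
  "distance_critical G \<longleftrightarrow>
     (\<forall>v \<in> verts G. \<exists>x \<in> verts G - {v}. \<exists>y \<in> verts G - {v}.
        graph_dist G x y \<noteq> graph_dist (pre_digraph.del_vert G v) x y)"

text \<open>
  ``Is an induced subgraph of'' is meant up to isomorphism:
  \<open>induced_subgraph\<close> itself asks for literal inclusion of vertex and arc sets,
  so both graphs would have to live on the same vertex type.
\<close>

definition is_induced_subgraph_of :: "('a, 'b) pre_digraph \<Rightarrow> ('c, 'd) pre_digraph \<Rightarrow> bool" where
  "is_induced_subgraph_of G H \<longleftrightarrow> (\<exists>K. induced_subgraph K H \<and> digraph_iso G K)"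

end

(*
  Glue a 5-cycle to every vertex of G. Every vertex v of the resulting graph is the middle of
  a path x - v - y inside some glued 5-cycle. In a 5-cycle the vertices x and y are distinct,
  non-adjacent and have v as their only common neighbour; gluing creates no further edge or
  common neighbour, because at most one of x and y is a vertex of G. Hence x and y are at
  distance 2, and deleting v increases this distance.
*)
theory Submission
  imports Defs
begin

lemma graph_dist_leI:
  assumes "pre_digraph.apath G x p y"
  shows "graph_dist G x y \<le> enat (length p)"
  unfolding graph_dist_def using assms by (intro INF_lower) simp

lemma graph_dist_geI:
  assumes "\<And>p. pre_digraph.apath G x p y \<Longrightarrow> n \<le> length p"
  shows "enat n \<le> graph_dist G x y"
  unfolding graph_dist_def using assms by (intro INF_greatest) simp

lemma (in wf_digraph) graph_dist_le_2:
  assumes "x \<rightarrow>\<^bsub>G\<^esub> v" "v \<rightarrow>\<^bsub>G\<^esub> y" "x \<noteq> v" "v \<noteq> y" "x \<noteq> y"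
  shows "graph_dist G x y \<le> 2"
proof -
  obtain d where d: "d \<in> arcs G" "tail G d = x" "head G d = v"
    using assms(1) by blast
  obtain e where e: "e \<in> arcs G" "tail G e = v" "head G e = y"
    using assms(2) by blast
  have "x \<in> verts G"
    using d tail_in_verts by blast
  then have "apath x [d, e] y"
    using d e assms by (simp add: apath_def awalk_def)
  from graph_dist_leI[OF this] show ?thesis
    by (simp add: numeral_eq_enat numeral_2_eq_2)
qed

lemma graph_dist_ge_3:
  assumes "x \<noteq> y" "\<not> x \<rightarrow>\<^bsub>G\<^esub> y" "\<And>w. \<not> (x \<rightarrow>\<^bsub>G\<^esub> w \<and> w \<rightarrow>\<^bsub>G\<^esub> y)"
  shows "3 \<le> graph_dist G x y"
proof -
  have "3 \<le> length p" if "pre_digraph.apath G x p y" for p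
  proof (rule ccontr)
    from that have p: "set p \<subseteq> arcs G" "pre_digraph.cas G x p y"
      by (auto simp: pre_digraph.apath_def pre_digraph.awalk_def)
    assume "\<not> 3 \<le> length p"
    then consider "p = []" | d where "p = [d]" | d e where "p = [d, e]"
      \<comment> \<open>The case rule of \<open>remdups_adj\<close> splits a list into empty,
        singleton and at least two elements.\<close>
      by (cases p rule: remdups_adj.cases) (auto simp: Suc_le_eq)
    then show False
      using p assms by cases (auto simp: arcs_ends_conv pre_digraph.cas.simps)
  qed
  from graph_dist_geI[OF this] show ?thesis
    by (simp add: numeral_eq_enat)
qed

text \<open>Reduces criticality to a local condition. The path through \<open>v\<close> gives
  distance at most 2; a path of length at most 2 that survives the deletion would need an edge
  \<open>x y\<close> or a common neighbour other than \<open>v\<close>.\<close>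

lemma (in loopfree_digraph) distance_criticalI:
  assumes "\<And>v. v \<in> verts G \<Longrightarrow> \<exists>x y. x \<rightarrow>\<^bsub>G\<^esub> v \<and> v \<rightarrow>\<^bsub>G\<^esub> y \<and> x \<noteq> y \<and> \<not> x \<rightarrow>\<^bsub>G\<^esub> y \<and>
             (\<forall>w. x \<rightarrow>\<^bsub>G\<^esub> w \<longrightarrow> w \<rightarrow>\<^bsub>G\<^esub> y \<longrightarrow> w = v)"
  shows "distance_critical G"
  unfolding distance_critical_def
proof
  fix v assume "v \<in> verts G"
  then obtain x y where xy: "x \<rightarrow>\<^bsub>G\<^esub> v" "v \<rightarrow>\<^bsub>G\<^esub> y" "x \<noteq> y" "\<not> x \<rightarrow>\<^bsub>G\<^esub> y"
    and uniq: "\<And>w. x \<rightarrow>\<^bsub>G\<^esub> w \<Longrightarrow> w \<rightarrow>\<^bsub>G\<^esub> y \<Longrightarrow> w = v"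
    using assms by blast
  have neq: "x \<noteq> v" "v \<noteq> y"
    using xy adj_not_same by blast+
  have sub: "a \<rightarrow>\<^bsub>G\<^esub> b \<and> a \<noteq> v \<and> b \<noteq> v" if "a \<rightarrow>\<^bsub>del_vert v\<^esub> b" for a b
    using that by (auto simp: arcs_ends_conv del_vert_simps)
  have "graph_dist G x y \<le> 2"
    using xy neq by (intro graph_dist_le_2)
  moreover have "3 \<le> graph_dist (del_vert v) x y"
    using xy sub uniq by (intro graph_dist_ge_3) blast+
  ultimately have "graph_dist G x y \<noteq> graph_dist (del_vert v) x y"
    by (auto simp: numeral_eq_enat dest: order_trans)
  then show "\<exists>x\<in>verts G - {v}. \<exists>y\<in>verts G - {v}.
      graph_dist G x y \<noteq> graph_dist (del_vert v) x y"
    using xy neq adj_in_verts by blast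
qed

text \<open>Arcs are the pairs of vertices themselves, which rules out parallel arcs.\<close>

definition rel_digraph :: "'a set \<Rightarrow> ('a \<Rightarrow> 'a \<Rightarrow> bool) \<Rightarrow> ('a, 'a \<times> 'a) pre_digraph" where
  "rel_digraph V E = \<lparr>verts = V, arcs = {(u, v). u \<in> V \<and> v \<in> V \<and> E u v}, tail = fst, head = snd\<rparr>"

lemma rel_digraph_simps [simp]:
  "verts (rel_digraph V E) = V"
  "arcs (rel_digraph V E) = {(u, v). u \<in> V \<and> v \<in> V \<and> E u v}"
  "tail (rel_digraph V E) = fst"
  "head (rel_digraph V E) = snd"
  by (simp_all add: rel_digraph_def)

lemma dominates_rel_digraph [simp]:
  "u \<rightarrow>\<^bsub>rel_digraph V E\<^esub> v \<longleftrightarrow> u \<in> V \<and> v \<in> V \<and> E u v"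
  by (auto simp: arcs_ends_conv image_iff)

lemma graph_rel_digraph:
  assumes "finite V" "symp E" "irreflp E"
  shows "graph (rel_digraph V E)"
proof unfold_locales
  show "finite (arcs (rel_digraph V E))"
    by (rule finite_subset[of _ "V \<times> V"]) (use assms in auto)
  show "symmetric (rel_digraph V E)"
    using assms by (auto simp: symmetric_def sym_def dest: sympD)
qed (use assms in \<open>auto simp: arc_to_ends_def irreflp_def\<close>)

definition c5_adj :: "nat \<Rightarrow> nat \<Rightarrow> bool" where
  "c5_adj k l \<longleftrightarrow> l = Suc k mod 5 \<or> k = Suc l mod 5"

text \<open>Vertex \<open>k\<close> of the 5-cycle glued to vertex \<open>i\<close> is \<open>5 * i + k\<close>; the vertex \<open>i\<close> itself is
  the one with \<open>k = 0\<close>.\<close>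

definition glue_c5 :: "(nat \<Rightarrow> nat \<Rightarrow> bool) \<Rightarrow> nat \<Rightarrow> nat \<Rightarrow> bool" where
  "glue_c5 R u v \<longleftrightarrow>
     u div 5 = v div 5 \<and> c5_adj (u mod 5) (v mod 5) \<or>
     u mod 5 = 0 \<and> v mod 5 = 0 \<and> R (u div 5) (v div 5)"

lemma less_5_cases:
  fixes k :: nat
  assumes "k < 5"
  obtains "k = 0" | "k = 1" | "k = 2" | "k = 3" | "k = 4"
  using assms by linarith

text \<open>Take the two cycle neighbours of \<open>k\<close>. Length 5 matters: in a triangle they
  would be adjacent, in a 4-cycle they would have a second common neighbour. Position 0 is where the
  cycle is glued, so \<open>a \<noteq> 0 \<or> b \<noteq> 0\<close> keeps one of them off the
  original graph.\<close>

lemma c5_neighbours: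
  assumes "k < 5"
  obtains a b where "a < 5" "b < 5" "a \<noteq> b" "a \<noteq> 0 \<or> b \<noteq> 0" "c5_adj a k" "c5_adj k b" "\<not> c5_adj a b"
    "\<And>l. l < 5 \<Longrightarrow> c5_adj a l \<Longrightarrow> c5_adj l b \<Longrightarrow> l = k"
\<comment> \<open>\<open>k + 4\<close> stands for \<open>k - 1\<close> modulo 5 and avoids truncated
  subtraction.\<close>
proof (rule that[of "(k + 4) mod 5" "Suc k mod 5"])
  show "(k + 4) mod 5 \<noteq> Suc k mod 5" "(k + 4) mod 5 \<noteq> 0 \<or> Suc k mod 5 \<noteq> 0"
    "c5_adj ((k + 4) mod 5) k" "c5_adj k (Suc k mod 5)" "\<not> c5_adj ((k + 4) mod 5) (Suc k mod 5)"
    using assms by (elim less_5_cases; simp add: c5_adj_def)+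
  show "l = k" if "l < 5" "c5_adj ((k + 4) mod 5) l" "c5_adj l (Suc k mod 5)" for l
    using assms that by (elim less_5_cases) (simp_all add: c5_adj_def)
qed simp_all

lemma symp_glue_c5: "symp R \<Longrightarrow> symp (glue_c5 R)"
  by (auto simp: symp_def glue_c5_def c5_adj_def)

lemma irreflp_glue_c5:
  assumes "irreflp R"
  shows "irreflp (glue_c5 R)"
proof -
  have "k \<noteq> Suc k mod 5" if "k < 5" for k :: nat
    using that by (elim less_5_cases) simp_all
  then show ?thesis
    using assms by (auto simp: irreflp_def glue_c5_def c5_adj_def)
qed

lemma distance_critical_glue_c5:
  assumes "symp R" "irreflp R"
  shows "distance_critical (rel_digraph {..<5 * n} (glue_c5 R))"
proof -
  let ?H = "rel_digraph {..<5 * n} (glue_c5 R)"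
  interpret H: graph ?H
    using assms by (intro graph_rel_digraph symp_glue_c5 irreflp_glue_c5) simp
  show ?thesis
  proof (rule H.distance_criticalI)
    fix v assume "v \<in> verts ?H"
    define q k where "q = v div 5" and "k = v mod 5"
    have q: "q < n"
      using \<open>v \<in> verts ?H\<close> by (simp add: q_def less_mult_imp_div_less mult.commute)
    have v: "v = 5 * q + k"
      by (simp add: q_def k_def)
    have "k < 5"
      by (simp add: k_def)
    then obtain a b where ab: "a < 5" "b < 5" "a \<noteq> b" "a \<noteq> 0 \<or> b \<noteq> 0"
        "c5_adj a k" "c5_adj k b" "\<not> c5_adj a b"
      and uniq: "\<And>l. l < 5 \<Longrightarrow> c5_adj a l \<Longrightarrow> c5_adj l b \<Longrightarrow> l = k"
      by (rule c5_neighbours) blast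
    \<comment> \<open>If one of the two edges came from \<open>R\<close>, its end among
      \<open>a\<close>, \<open>b\<close> would be 0 and the other nonzero. The other edge would then
      stay in cycle \<open>q\<close>, so \<open>w div 5 = q\<close> and \<open>R q q\<close>,
      against irreflexivity.\<close>
    have same_cycle: "w div 5 = q \<and> c5_adj a (w mod 5) \<and> c5_adj (w mod 5) b"
      if "glue_c5 R (5 * q + a) w" "glue_c5 R w (5 * q + b)" for w
      using that ab assms(2) by (auto simp: glue_c5_def irreflp_def)
    have "w = v" if "glue_c5 R (5 * q + a) w" "glue_c5 R w (5 * q + b)" for w
      using same_cycle[OF that] uniq[of "w mod 5"] div_mult_mod_eq[of w 5] by (simp add: v)
    then show "\<exists>x y. x \<rightarrow>\<^bsub>?H\<^esub> v \<and> v \<rightarrow>\<^bsub>?H\<^esub> y \<and> x \<noteq> y \<and> \<not> x \<rightarrow>\<^bsub>?H\<^esub> y \<and>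
        (\<forall>w. x \<rightarrow>\<^bsub>?H\<^esub> w \<longrightarrow> w \<rightarrow>\<^bsub>?H\<^esub> y \<longrightarrow> w = v)"
      using ab q \<open>k < 5\<close>
      \<comment> \<open>The witnesses are the neighbours of \<open>v\<close> on its own cycle;
        \<open>q < n\<close> puts the whole cycle into the vertex set. They are not adjacent through
        \<open>R\<close>, since \<open>a\<close> and \<open>b\<close> are not both 0.\<close>
      by (intro exI[of _ "5 * q + a"] exI[of _ "5 * q + b"]) (auto simp: glue_c5_def v)
  qed
qed

lemma (in nomulti_digraph) is_induced_subgraph_of_rel_digraphI:
  assumes inj: "inj_on f (verts G)" and sub: "f ` verts G \<subseteq> V"
    and E: "\<And>u v. u \<in> verts G \<Longrightarrow> v \<in> verts G \<Longrightarrow> E (f u) (f v) \<longleftrightarrow> u \<rightarrow>\<^bsub>G\<^esub> v"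
  shows "is_induced_subgraph_of G (rel_digraph V E)"
proof -
  \<comment> \<open>Sending an arc to the pair of images of its ends makes the image of
    \<open>G\<close> a literal subgraph of \<open>rel_digraph V E\<close>. This map is injective on
    arcs because \<open>G\<close> has no parallel arcs.\<close>
  let ?h = "\<lparr>iso_verts = f, iso_arcs = \<lambda>e. (f (tail G e), f (head G e)),
    iso_head = snd, iso_tail = fst\<rparr>"
  have "inj_on (iso_arcs ?h) (arcs G)"
  proof (rule inj_onI)
    fix d e assume "d \<in> arcs G" "e \<in> arcs G" "iso_arcs ?h d = iso_arcs ?h e"
    then show "d = e"
      using inj by (intro no_multi_arcs) (auto simp: arc_to_ends_def dest: inj_onD)
  qed
  then have iso: "digraph_isomorphism ?h"
    using inj wf_digraph by (simp add: digraph_isomorphism_def)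
  have wfH: "wf_digraph (rel_digraph V E)"
    by unfold_locales auto
  \<comment> \<open>This equality is what makes the subgraph induced: one inclusion says that
    \<open>f\<close> preserves adjacency, the other that it reflects it.\<close>
  have arcs: "arcs (app_iso ?h G) = {e \<in> arcs (rel_digraph V E).
      fst e \<in> f ` verts G \<and> snd e \<in> f ` verts G}"
  proof (intro equalityI subsetI)
    fix e assume "e \<in> arcs (app_iso ?h G)"
    then obtain d where "d \<in> arcs G" "e = (f (tail G d), f (head G d))"
      by auto
    then show "e \<in> {e \<in> arcs (rel_digraph V E). fst e \<in> f ` verts G \<and> snd e \<in> f ` verts G}"
      using sub by (auto simp: E arcs_ends_conv)
  next
    fix e assume "e \<in> {e \<in> arcs (rel_digraph V E). fst e \<in> f ` verts G \<and> snd e \<in> f ` verts G}"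
    then obtain u v where "e = (f u, f v)" "u \<rightarrow>\<^bsub>G\<^esub> v"
      using E by auto
    then show "e \<in> arcs (app_iso ?h G)"
      by (auto simp: arcs_ends_conv)
  qed
  have "induced_subgraph (app_iso ?h G) (rel_digraph V E)"
    unfolding induced_subgraph_def subgraph_def compatible_def
    using arcs sub wfH wf_digraphI_app_iso[OF iso] by auto
  then show ?thesis
    using iso by (auto simp: is_induced_subgraph_of_def digraph_iso_def)
qed

theorem theorem5p9:
  fixes G :: "('a, 'b) pre_digraph"
  assumes "graph G"
  shows "\<exists>H :: (nat, nat \<times> nat) pre_digraph.
           graph H \<and> distance_critical H \<and> is_induced_subgraph_of G H"
proof -
  interpret graph G by fact
  obtain f :: "'a \<Rightarrow> nat" and n where f: "f ` verts G = {i. i < n}" "inj_on f (verts G)"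
    using finite_imp_inj_to_nat_seg[OF finite_verts] by blast
  \<comment> \<open>Adjacency of \<open>G\<close> carried over to the numbers below
    \<open>n\<close>. It is false elsewhere, so symmetry and irreflexivity hold on all of
    \<open>nat\<close>.\<close>
  define R where "R i j \<longleftrightarrow> (\<exists>u v. u \<rightarrow>\<^bsub>G\<^esub> v \<and> i = f u \<and> j = f v)" for i j
  have R_iff: "R (f u) (f v) \<longleftrightarrow> u \<rightarrow>\<^bsub>G\<^esub> v" if "u \<in> verts G" "v \<in> verts G" for u v
    unfolding R_def using that inj_onD[OF f(2)] adj_in_verts by metis
  have R: "symp R" "irreflp R"
  proof -
    show "symp R"
      using arcs_ends_symmetric[OF sym_arcs] by (auto simp: symp_def R_def)
    show "irreflp R"
      unfolding irreflp_def R_def using inj_onD[OF f(2)] adj_in_verts adj_not_same by metis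
  qed
  let ?H = "rel_digraph {..<5 * n} (glue_c5 R)"
  have "graph ?H"
    using R by (intro graph_rel_digraph symp_glue_c5 irreflp_glue_c5) simp
  moreover have "distance_critical ?H"
    using R by (rule distance_critical_glue_c5)
  moreover have "is_induced_subgraph_of G ?H"
  \<comment> \<open>\<open>5 * f u\<close> is position 0 of cycle \<open>f u\<close>, the vertex at
    which that cycle is glued. Between two such positions only \<open>R\<close> can give an edge, as
    0 is not its own neighbour on the 5-cycle.\<close>
  proof (rule is_induced_subgraph_of_rel_digraphI[of "\<lambda>u. 5 * f u"])
    show "inj_on (\<lambda>u. 5 * f u) (verts G)"
      using f(2) by (simp add: inj_on_def)
    show "(\<lambda>u. 5 * f u) ` verts G \<subseteq> {..<5 * n}"
      using f(1) by auto
    show "glue_c5 R (5 * f u) (5 * f v) \<longleftrightarrow> u \<rightarrow>\<^bsub>G\<^esub> v" if "u \<in> verts G" "v \<in> verts G" for u v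
      using that by (simp add: glue_c5_def c5_adj_def R_iff)
  qed
  ultimately show ?thesis
    by blast
qed

end
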